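(* Let $(W,S)$ be a Coxeter system, let $u,w\in W$ with $u<w$ in Bruhat order, and let $n$ be a nonnegative integer. If $n<a(u,w)$ or $n>\ell(u,w)$, then $[(q-1)^n](R_{uw})=0$. Otherwise (i.e. $a(u,w)\le n\le \ell(u,w)$), $[(q-1)^n](R_{uw})>0$. In particular, $(q-1)^{a(u,w)}$ is the largest power of $q-1$ dividing $R_{uw}(q)$, and $R_{uw}(q)\ge_{q-1}0$ for all $u,w\in W$.
   Context: $(W,S)$ is a Coxeter system with length function $\ell$ and set of reflections $T=\bigcup_{w\in W}w^{-1}Sw$. Write $u\to w$ if $w=ut$ for some $t\in T$ and $\ell(u)<\ell(w)$; Bruhat order $u\le w$ means there is a chain $u\to v_1\to\cdots\to v_n=w$ (the directed graph on $W$ with these edges is the Bruhat graph). Set $\ell(u,w)=\ell(w)-\ell(u)$. For $u\le w$, the absolute length $a(u,w)$ is the minimum $n\ge0$ such that there is a directed path $u\to v_1\to\cdots\to v_n=w$. The $R$-polynomials $R_{uw}(q)\in\mathbb{Z}[q]$ are the unique family with $R_{uw}=0$ if $u\not\le w$, $R_{ww}=1$, and, for $s\in S$ with $ws<w$: $R_{uw}=R_{us,ws}$ if $us<u$, and $R_{uw}=qR_{us,ws}+(q-1)R_{u,ws}$ if $u<us$. For a real polynomial $f$, $[(q-1)^n](f):=f^{(n)}(1)/n!$ is the coefficient of $(q-1)^n$ in the expansion of $f$ in powers of $q-1$, and $f\le_{q-1}g$ means $[(q-1)^n](f)\le[(q-1)^n](g)$ for all $n\ge0$. *)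

theory Defs
  imports
    "HOL-Algebra.Multiplicative_Group"
    "HOL-Algebra.Generated_Groups"
    "HOL-Computational_Algebra.Polynomial"
begin

text \<open>
  A group word is a list of signed letters: \<open>(False, x)\<close> stands for the letter \<open>x\<close> and
  \<open>(True, x)\<close> for its formal inverse. Two words over \<open>X\<close> are related by \<open>presentation_eq X Rel\<close>
  iff they represent the same element of the free group on \<open>X\<close> modulo the normal closure of \<open>Rel\<close>.
\<close>

inductive presentation_eq ::
  "'a set \<Rightarrow> (bool \<times> 'a) list set \<Rightarrow> (bool \<times> 'a) list \<Rightarrow> (bool \<times> 'a) list \<Rightarrow> bool"
  for X :: "'a set" and Rel :: "(bool \<times> 'a) list set" where
  refl: "p \<in> lists (UNIV \<times> X) \<Longrightarrow> presentation_eq X Rel p p"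
| sym: "presentation_eq X Rel p p' \<Longrightarrow> presentation_eq X Rel p' p"
| trans: "presentation_eq X Rel p p' \<Longrightarrow> presentation_eq X Rel p' p'' \<Longrightarrow> presentation_eq X Rel p p''"
| cancel: "p \<in> lists (UNIV \<times> X) \<Longrightarrow> p' \<in> lists (UNIV \<times> X) \<Longrightarrow> x \<in> X \<Longrightarrow>
    presentation_eq X Rel (p @ [(b, x), (\<not> b, x)] @ p') (p @ p')"
| relator: "p \<in> lists (UNIV \<times> X) \<Longrightarrow> p' \<in> lists (UNIV \<times> X) \<Longrightarrow>
    r \<in> Rel \<Longrightarrow> r \<in> lists (UNIV \<times> X) \<Longrightarrow>
    presentation_eq X Rel (p @ r @ p') (p @ p')"

definition word_value :: "('a, 'b) monoid_scheme \<Rightarrow> (bool \<times> 'a) list \<Rightarrow> 'a" where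
  "word_value G p =
     foldr (\<lambda>(b, x) y. (if b then inv\<^bsub>G\<^esub> x else x) \<otimes>\<^bsub>G\<^esub> y) p \<one>\<^bsub>G\<^esub>"

definition presented_by ::
  "('a, 'b) monoid_scheme \<Rightarrow> 'a set \<Rightarrow> (bool \<times> 'a) list set \<Rightarrow> bool" where
  "presented_by G X Rel \<longleftrightarrow>
     X \<subseteq> carrier G \<and> generate G X = carrier G \<and>
     (\<forall>p\<in>lists (UNIV \<times> X). \<forall>p'\<in>lists (UNIV \<times> X).
        word_value G p = word_value G p' \<longleftrightarrow> presentation_eq X Rel p p')"

text \<open>
  \<open>group.ord\<close> is \<open>0\<close> for elements of infinite order, so the relators \<open>(s t)\<^sup>m\<close> are imposed
  exactly for the pairs whose product has finite order \<open>m\<close> (including \<open>s = t\<close>, where \<open>m = 1\<close>).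
\<close>

definition coxeter_relators :: "('a, 'b) monoid_scheme \<Rightarrow> 'a set \<Rightarrow> (bool \<times> 'a) list set" where
  "coxeter_relators W S =
     {concat (replicate (group.ord W (s \<otimes>\<^bsub>W\<^esub> t)) [(False, s), (False, t)]) | s t.
        s \<in> S \<and> t \<in> S \<and> group.ord W (s \<otimes>\<^bsub>W\<^esub> t) \<noteq> 0}"

definition coxeter_system :: "('a, 'b) monoid_scheme \<Rightarrow> 'a set \<Rightarrow> bool" where
  "coxeter_system W S \<longleftrightarrow>
     group W \<and> S \<subseteq> carrier W \<and> (\<forall>s\<in>S. group.ord W s = 2) \<and>
     presented_by W S (coxeter_relators W S)"

definition cox_length :: "('a, 'b) monoid_scheme \<Rightarrow> 'a set \<Rightarrow> 'a \<Rightarrow> nat" where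
  "cox_length W S w =
     (LEAST n. \<exists>p\<in>lists S. length p = n \<and> foldr (\<otimes>\<^bsub>W\<^esub>) p \<one>\<^bsub>W\<^esub> = w)"

definition reflections :: "('a, 'b) monoid_scheme \<Rightarrow> 'a set \<Rightarrow> 'a set" where
  "reflections W S = (\<Union>w\<in>carrier W. {inv\<^bsub>W\<^esub> w \<otimes>\<^bsub>W\<^esub> s \<otimes>\<^bsub>W\<^esub> w | s. s \<in> S})"

definition bruhat_graph :: "('a, 'b) monoid_scheme \<Rightarrow> 'a set \<Rightarrow> ('a \<times> 'a) set" where
  "bruhat_graph W S =
     {(u, w). u \<in> carrier W \<and> w \<in> carrier W \<and>
        (\<exists>t\<in>reflections W S. w = u \<otimes>\<^bsub>W\<^esub> t) \<and> cox_length W S u < cox_length W S w}"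

definition bruhat_le :: "('a, 'b) monoid_scheme \<Rightarrow> 'a set \<Rightarrow> 'a \<Rightarrow> 'a \<Rightarrow> bool" where
  "bruhat_le W S u w \<longleftrightarrow>
     u \<in> carrier W \<and> w \<in> carrier W \<and> (u, w) \<in> (bruhat_graph W S)\<^sup>*"

definition bruhat_less :: "('a, 'b) monoid_scheme \<Rightarrow> 'a set \<Rightarrow> 'a \<Rightarrow> 'a \<Rightarrow> bool" where
  "bruhat_less W S u w \<longleftrightarrow> bruhat_le W S u w \<and> u \<noteq> w"

definition rel_length :: "('a, 'b) monoid_scheme \<Rightarrow> 'a set \<Rightarrow> 'a \<Rightarrow> 'a \<Rightarrow> int" where
  "rel_length W S u w = int (cox_length W S w) - int (cox_length W S u)"

definition absolute_length :: "('a, 'b) monoid_scheme \<Rightarrow> 'a set \<Rightarrow> 'a \<Rightarrow> 'a \<Rightarrow> nat" where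
  "absolute_length W S u w = (LEAST n. (u, w) \<in> bruhat_graph W S ^^ n)"

definition is_R_family ::
  "('a, 'b) monoid_scheme \<Rightarrow> 'a set \<Rightarrow> ('a \<Rightarrow> 'a \<Rightarrow> int poly) \<Rightarrow> bool" where
  "is_R_family W S R \<longleftrightarrow>
     (\<forall>u w. \<not> bruhat_le W S u w \<longrightarrow> R u w = 0) \<and>
     (\<forall>w\<in>carrier W. R w w = 1) \<and>
     (\<forall>u\<in>carrier W. \<forall>w\<in>carrier W. \<forall>s\<in>S. bruhat_less W S (w \<otimes>\<^bsub>W\<^esub> s) w \<longrightarrow>
        (bruhat_less W S (u \<otimes>\<^bsub>W\<^esub> s) u \<longrightarrow>
           R u w = R (u \<otimes>\<^bsub>W\<^esub> s) (w \<otimes>\<^bsub>W\<^esub> s)) \<and>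
        (bruhat_less W S u (u \<otimes>\<^bsub>W\<^esub> s) \<longrightarrow>
           R u w = [:0, 1:] * R (u \<otimes>\<^bsub>W\<^esub> s) (w \<otimes>\<^bsub>W\<^esub> s)
                 + [:-1, 1:] * R u (w \<otimes>\<^bsub>W\<^esub> s)))"

text \<open>
  The first clause of \<open>is_R_family\<close> also fixes the values outside the carrier (to \<open>0\<close>), so the
  family is unique as a total function.
\<close>

definition R_poly :: "('a, 'b) monoid_scheme \<Rightarrow> 'a set \<Rightarrow> 'a \<Rightarrow> 'a \<Rightarrow> int poly" where
  "R_poly W S = (THE R. is_R_family W S R)"

definition real_R_poly :: "('a, 'b) monoid_scheme \<Rightarrow> 'a set \<Rightarrow> 'a \<Rightarrow> 'a \<Rightarrow> real poly" where
  "real_R_poly W S u w = map_poly real_of_int (R_poly W S u w)"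

definition coeff_qm1 :: "nat \<Rightarrow> real poly \<Rightarrow> real" where
  "coeff_qm1 n f = poly ((pderiv ^^ n) f) 1 / fact n"

definition le_qm1 :: "real poly \<Rightarrow> real poly \<Rightarrow> bool" where
  "le_qm1 f g \<longleftrightarrow> (\<forall>n. coeff_qm1 n f \<le> coeff_qm1 n g)"

end

theory Submission
  imports Defs
begin

text \<open>
  Call \<open>t\<close> an inversion of \<open>w\<close> if it occurs an odd number of times among the reflections of a word
  for \<open>w\<close>; the presentation makes this independent of the word, and for reflections \<open>t\<close> it is
  equivalent to \<open>\<ell>(wt) < \<ell>(w)\<close>. It follows that an edge \<open>u \<rightarrow> v\<close> of the Bruhat graph with
  \<open>v \<noteq> us\<close> gives an edge \<open>us \<rightarrow> vs\<close>. Hence, for \<open>ws < w\<close>, we have \<open>a(u, w) = a(us, ws)\<close> if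
  \<open>us < u\<close>, and \<open>a(u, w) = min (a(us, ws)) (a(u, ws) + 1)\<close> if \<open>u < us\<close>. With \<open>x = q - 1\<close> the
  recursion \<open>R u w = (x + 1) R (us) (ws) + x R u (ws)\<close> has nonnegative coefficients, so positivity
  of the coefficients follows by induction on \<open>\<ell>(w)\<close>. The family \<open>R\<close> itself comes
  from the action of the Hecke algebra on polynomial-valued functions on \<open>W\<close>.
\<close>

section \<open>Inversions and the strong exchange property\<close>

definition (in monoid) word_prod :: "'a list \<Rightarrow> 'a" where
  "word_prod p = foldr (\<otimes>) p \<one>"

definition (in group) conj_by :: "'a \<Rightarrow> 'a \<Rightarrow> 'a" where
  "conj_by g x = g \<otimes> x \<otimes> inv g"

context monoid
begin

lemma word_prod_simps [simp]:
  "word_prod [] = \<one>" "word_prod (s # p) = s \<otimes> word_prod p"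
  by (simp_all add: word_prod_def)

lemma word_prod_closed [simp]: "set p \<subseteq> carrier G \<Longrightarrow> word_prod p \<in> carrier G"
  by (induction p) auto

lemma word_prod_append [simp]:
  "set p \<subseteq> carrier G \<Longrightarrow> set p' \<subseteq> carrier G \<Longrightarrow> word_prod (p @ p') = word_prod p \<otimes> word_prod p'"
  by (induction p) (auto simp: m_assoc)

end

context group
begin

lemma conj_by_closed [simp]: "g \<in> carrier G \<Longrightarrow> x \<in> carrier G \<Longrightarrow> conj_by g x \<in> carrier G"
  by (simp add: conj_by_def)

lemma conj_by_mult:
  "g \<in> carrier G \<Longrightarrow> h \<in> carrier G \<Longrightarrow> x \<in> carrier G \<Longrightarrow>
   conj_by (g \<otimes> h) x = conj_by g (conj_by h x)"
  by (simp add: conj_by_def m_assoc inv_mult_group)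

lemma conj_by_one [simp]: "x \<in> carrier G \<Longrightarrow> conj_by \<one> x = x"
  by (simp add: conj_by_def)

lemma conj_by_self [simp]: "x \<in> carrier G \<Longrightarrow> conj_by x x = x"
  by (simp add: conj_by_def m_assoc)

lemma conj_by_eq_iff:
  assumes "g \<in> carrier G" "x \<in> carrier G" "y \<in> carrier G"
  shows "conj_by g x = y \<longleftrightarrow> x = conj_by (inv g) y"
proof -
  have "conj_by (inv g) (conj_by g x) = x" "conj_by g (conj_by (inv g) y) = y"
    using assms by (simp_all flip: conj_by_mult)
  then show ?thesis by metis
qed

lemma mult_conj_by:
  "g \<in> carrier G \<Longrightarrow> x \<in> carrier G \<Longrightarrow> conj_by g x \<otimes> g = g \<otimes> x"
  by (simp add: conj_by_def m_assoc)

end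

text \<open>A named constant, so that \<open>simp\<close> treats q as an atom.\<close>

definition qvar :: "int poly" where
  "qvar = [:0, 1:]"

lemma qvar_nonzero [simp]: "qvar \<noteq> 0"
  by (simp add: qvar_def)

lemma qvar_minus_one: "qvar - 1 = [:-1, 1:]"
  by (simp add: qvar_def one_pCons)

section \<open>Coxeter systems and the parity of reflections in a word\<close>

locale coxeter = group W for W (structure) +
  fixes S :: "'a set"
  assumes coxeter: "coxeter_system W S"
begin

lemma gen_carrier [simp]: "s \<in> S \<Longrightarrow> s \<in> carrier W"
  using coxeter by (auto simp: coxeter_system_def)

lemma lists_carrier [simp]: "set p \<subseteq> S \<Longrightarrow> set p \<subseteq> carrier W"
  by auto

lemma gen_square [simp]: "s \<in> S \<Longrightarrow> s \<otimes> s = \<one>"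
  using coxeter pow_ord_eq_1[of s] by (auto simp: coxeter_system_def numeral_2_eq_2)

lemma gen_inv [simp]: "s \<in> S \<Longrightarrow> inv s = s"
  by (simp add: inv_equality)

lemma mult_gen_gen [simp]: "s \<in> S \<Longrightarrow> u \<in> carrier W \<Longrightarrow> u \<otimes> s \<otimes> s = u"
  by (simp add: m_assoc)

lemma gen_gen_mult [simp]: "s \<in> S \<Longrightarrow> u \<in> carrier W \<Longrightarrow> s \<otimes> (s \<otimes> u) = u"
  by (simp flip: m_assoc)

text \<open>Generators are involutions, so the signs of letters do not affect the value.\<close>

lemma word_value_eq:
  "snd ` set p \<subseteq> S \<Longrightarrow> word_value W p = word_prod (map snd p)"
  by (induction p) (auto simp: word_value_def)

lemma ex_word:
  assumes "w \<in> carrier W"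
  shows "\<exists>p. set p \<subseteq> S \<and> word_prod p = w"
proof -
  have "w \<in> generate W S"
    using assms coxeter by (auto simp: coxeter_system_def presented_by_def)
  then show ?thesis
  proof induction
    case one
    show ?case by (rule exI[of _ "[]"]) simp
  next
    case (incl h)
    then show ?case by (intro exI[of _ "[h]"]) simp
  next
    case (inv h)
    then show ?case by (intro exI[of _ "[h]"]) simp
  next
    case (eng h1 h2)
    then obtain p1 p2 where "set p1 \<subseteq> S" "word_prod p1 = h1" "set p2 \<subseteq> S" "word_prod p2 = h2"
      by blast
    then show ?case by (intro exI[of _ "p1 @ p2"]) auto
  qed
qed

text \<open>
  The reflections of a word \<open>s\<^sub>1 \<dots> s\<^sub>k\<close> are \<open>s\<^sub>k \<dots> s\<^sub>i\<^sub>+\<^sub>1 s\<^sub>i s\<^sub>i\<^sub>+\<^sub>1 \<dots> s\<^sub>k\<close>; \<open>odd_refl\<close> is the parity of the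
  number of times \<open>t\<close> occurs among them.
\<close>

primrec odd_refl :: "'a list \<Rightarrow> 'a \<Rightarrow> bool" where
  "odd_refl [] t \<longleftrightarrow> False"
| "odd_refl (s # p) t \<longleftrightarrow> odd_refl p t \<noteq> (conj_by (word_prod p) t = s)"

lemma odd_refl_append:
  assumes "set p \<subseteq> S" "set p' \<subseteq> S" "t \<in> carrier W"
  shows "odd_refl (p @ p') t \<longleftrightarrow> odd_refl p (conj_by (word_prod p') t) \<noteq> odd_refl p' t"
  using assms by (induction p) (auto simp: conj_by_mult)

text \<open>Read from the right end, the reflections of the word (st)^n are (ts)^i t for i = 0, ...,
  2n - 1.\<close>

lemma odd_refl_power:
  assumes s: "s \<in> S" and t: "t \<in> S" and x: "x \<in> carrier W"
  shows "odd_refl (concat (replicate n [s, t])) x \<longleftrightarrow>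
           odd (card {i. i < 2 * n \<and> x = (t \<otimes> s) [^] i \<otimes> t})"
proof (induction n)
  case 0
  show ?case by simp
next
  case (Suc n)
  let ?f = "\<lambda>i. x = (t \<otimes> s) [^] i \<otimes> t"
  let ?p = "concat (replicate n [s, t])"
  have card_Suc: "odd (card {i. i < Suc k \<and> ?f i}) \<longleftrightarrow> odd (card {i. i < k \<and> ?f i}) \<noteq> ?f k" for k
  proof -
    have "{i. i < Suc k \<and> ?f i} = (if ?f k then insert k {i. i < k \<and> ?f i} else {i. i < k \<and> ?f i})"
      by (auto simp: less_Suc_eq)
    then show ?thesis by simp
  qed
  have p: "set ?p \<subseteq> S" using s t by auto
  have wp: "word_prod ?p = (s \<otimes> t) [^] n"
  proof (induction n)
    case (Suc n)
    then show ?case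
      using s t nat_pow_Suc2[of "s \<otimes> t" n] by (simp add: m_assoc)
  qed simp
  have inv_st: "inv ((s \<otimes> t) [^] n) = (t \<otimes> s) [^] n"
    using s t nat_pow_inv[of "s \<otimes> t" n] by (simp add: inv_mult_group)
  have swap: "t \<otimes> (s \<otimes> t) [^] k = (t \<otimes> s) [^] k \<otimes> t" for k :: nat
  proof (induction k)
    case (Suc k)
    have "t \<otimes> (s \<otimes> t) [^] Suc k = (t \<otimes> (s \<otimes> t) [^] k) \<otimes> (s \<otimes> t)"
      using s t by (simp add: m_assoc)
    also have "\<dots> = (t \<otimes> s) [^] Suc k \<otimes> t"
      using s t unfolding Suc by (simp add: m_assoc)
    finally show ?case .
  qed (use s t in simp)
  have c: "conj_by (word_prod ?p) x = y \<longleftrightarrow> x = (t \<otimes> s) [^] n \<otimes> y \<otimes> (s \<otimes> t) [^] n"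
    if "y \<in> carrier W" for y
    unfolding wp using s t x that by (subst conj_by_eq_iff) (auto simp: conj_by_def inv_st[symmetric])
  \<comment> \<open>The letters t and s of the block added in front contribute the indices 2n and 2n
    + 1.\<close>
  have e1: "conj_by (word_prod ?p) x = t \<longleftrightarrow> ?f (2 * n)"
    using s t nat_pow_mult[of "t \<otimes> s" n n] m_assoc[of "(t \<otimes> s) [^] n" "(t \<otimes> s) [^] n" t]
    by (simp add: c m_assoc swap mult_2)
  have "conj_by t (conj_by (word_prod ?p) x) = s \<longleftrightarrow> conj_by (word_prod ?p) x = t \<otimes> s \<otimes> t"
    using s t x p by (subst conj_by_eq_iff) (auto simp: conj_by_def)
  also have "\<dots> \<longleftrightarrow> ?f (Suc (2 * n))"
  proof -
    have "(t \<otimes> s) [^] n \<otimes> (t \<otimes> s \<otimes> t) \<otimes> (s \<otimes> t) [^] n = (t \<otimes> s) [^] n \<otimes> (t \<otimes> s) \<otimes> (t \<otimes> (s \<otimes> t) [^] n)"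
      using s t by (simp add: m_assoc)
    also have "\<dots> = (t \<otimes> s) [^] Suc n \<otimes> (t \<otimes> s) [^] n \<otimes> t"
      using s t by (simp add: swap m_assoc)
    also have "\<dots> = (t \<otimes> s) [^] (Suc (2 * n)) \<otimes> t"
      using s t by (subst nat_pow_mult) (auto simp: mult_2)
    finally show ?thesis using s t by (subst c) auto
  qed
  finally have e2: "conj_by t (conj_by (word_prod ?p) x) = s \<longleftrightarrow> ?f (Suc (2 * n))" .
  have "odd_refl (concat (replicate (Suc n) [s, t])) x \<longleftrightarrow>
      (odd_refl ?p x \<noteq> ?f (2 * n)) \<noteq> ?f (Suc (2 * n))"
    using s t x p e1 e2 by (simp add: conj_by_mult) 
  also have "\<dots> \<longleftrightarrow> odd (card {i. i < 2 * Suc n \<and> ?f i})"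
    using Suc by (simp only: card_Suc mult_Suc_right add_2_eq_Suc)
  finally show ?case .
qed

text \<open>With m the order of st, also (ts)^m = 1, so the 2m reflections (ts)^i t repeat with
  period m and each is counted an even number of times.\<close>

lemma odd_refl_relator:
  assumes s: "s \<in> S" and t: "t \<in> S" and x: "x \<in> carrier W"
  shows "\<not> odd_refl (concat (replicate (ord (s \<otimes> t)) [s, t])) x"
proof -
  define m where "m = ord (s \<otimes> t)"
  define P where "P = (\<lambda>i::nat. x = (t \<otimes> s) [^] i \<otimes> t)"
  have "(s \<otimes> t) [^] m = \<one>" using s t by (simp add: m_def pow_ord_eq_1)
  then have "(t \<otimes> s) [^] m = \<one>"
    using s t nat_pow_inv[of "s \<otimes> t" m] by (simp add: inv_mult_group)
  then have periodic: "P (i + m) = P i" for i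
    using s t nat_pow_mult[of "t \<otimes> s" i m] by (simp add: P_def)
  then have periodic': "P (i - m) = P i" if "m \<le> i" for i
    using that by (metis le_add_diff_inverse2)
  have "bij_betw (\<lambda>i. i + m) {i. i < m \<and> P i} {i. m \<le> i \<and> i < 2 * m \<and> P i}"
    by (intro bij_betwI[where g = "\<lambda>i. i - m"]) (auto simp: periodic periodic')
  then have "card {i. i < m \<and> P i} = card {i. m \<le> i \<and> i < 2 * m \<and> P i}"
    by (rule bij_betw_same_card)
  moreover have "card {i. i < 2 * m \<and> P i} = card {i. i < m \<and> P i} + card {i. m \<le> i \<and> i < 2 * m \<and> P i}"
    by (subst card_Un_disjoint[symmetric]) (auto intro!: arg_cong[of _ _ card])
  ultimately show ?thesis
    using odd_refl_power[OF s t x, of m] by (simp add: m_def P_def)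
qed

lemma odd_refl_insert_trivial:
  assumes "set p \<subseteq> S" "set p' \<subseteq> S" "set r \<subseteq> S" "t \<in> carrier W"
    and "word_prod r = \<one>" "\<And>t. t \<in> carrier W \<Longrightarrow> \<not> odd_refl r t"
  shows "odd_refl (p @ r @ p') t \<longleftrightarrow> odd_refl (p @ p') t"
  using assms by (simp add: odd_refl_append)

text \<open>Both generating moves of \<open>presentation_eq\<close> insert a word of value
  \<open>\<one>\<close> in which no reflection occurs an odd number of times.\<close>

lemma odd_refl_presentation_eq:
  assumes "presentation_eq S (coxeter_relators W S) p p'" "t \<in> carrier W"
  shows "odd_refl (map snd p) t \<longleftrightarrow> odd_refl (map snd p') t"
proof -
  have rel: "word_prod (map snd r) = \<one> \<and> (\<forall>t\<in>carrier W. \<not> odd_refl (map snd r) t)"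
    if r: "r \<in> coxeter_relators W S" "snd ` set r \<subseteq> S" for r
  proof -
    have r_lists: "r \<in> lists (UNIV \<times> S)"
      using r by (auto simp: in_lists_conv_set)
    \<comment> \<open>A relator has value \<open>\<one>\<close> because the presentation identifies
      it with the empty word.\<close>
    have "presentation_eq S (coxeter_relators W S) ([] @ r @ []) ([] @ [])"
      using r by (intro presentation_eq.relator) (auto simp: in_lists_conv_set)
    then have "presentation_eq S (coxeter_relators W S) r []" by simp
    then have "word_value W r = word_value W []"
      using coxeter r_lists by (simp add: coxeter_system_def presented_by_def)
    then have "word_prod (map snd r) = \<one>"
      using r by (simp add: word_value_eq)
    moreover obtain s t where st: "s \<in> S" "t \<in> S"
      "r = concat (replicate (ord (s \<otimes> t)) [(False, s), (False, t)])"
      using r by (auto simp: coxeter_relators_def)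
    then have "map snd r = concat (replicate (ord (s \<otimes> t)) [s, t])"
      by (simp add: map_concat)
    ultimately show ?thesis using st odd_refl_relator by simp
  qed
  from assms(1) have "\<forall>t\<in>carrier W. odd_refl (map snd p) t \<longleftrightarrow> odd_refl (map snd p') t"
  proof induction
    case (cancel p p' x b)
    \<comment> \<open>After \<open>map snd\<close> the cancelled pair is \<open>[x, x]\<close>,
      whose two reflections are both \<open>x\<close>.\<close>
    then have "conj_by x y = x \<longleftrightarrow> y = x" if "y \<in> carrier W" for y
      using that by (subst conj_by_eq_iff) (auto simp: conj_by_def)
    with cancel odd_refl_insert_trivial[of "map snd p" "map snd p'" "[x, x]"] show ?case
      by (simp add: in_lists_conv_set image_subset_iff mem_Times_iff)
  next
    case (relator p p' r)
    with rel[of r] odd_refl_insert_trivial[of "map snd p" "map snd p'" "map snd r"] show ?case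
      by (simp add: in_lists_conv_set image_subset_iff mem_Times_iff)
  qed auto
  with assms(2) show ?thesis by blast
qed

lemma odd_refl_cong:
  assumes "set p \<subseteq> S" "set p' \<subseteq> S" "word_prod p = word_prod p'" "t \<in> carrier W"
  shows "odd_refl p t \<longleftrightarrow> odd_refl p' t"
proof -
  let ?p = "map (Pair False) p" and ?p' = "map (Pair False) p'"
  have [simp]: "map snd (map (Pair False) xs) = xs" for xs :: "'a list"
    by (induction xs) auto
  have "?p \<in> lists (UNIV \<times> S)" "?p' \<in> lists (UNIV \<times> S)"
    using assms by (auto simp: in_lists_conv_set)
  moreover have "word_value W ?p = word_value W ?p'"
    using assms by (subst (1 2) word_value_eq) (auto simp: image_image simp del: map_map)
  ultimately have "presentation_eq S (coxeter_relators W S) ?p ?p'"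
    using coxeter unfolding coxeter_system_def presented_by_def by blast
  from odd_refl_presentation_eq[OF this assms(4)] show ?thesis by (simp del: map_map)
qed

definition inversion :: "'a \<Rightarrow> 'a \<Rightarrow> bool" where
  "inversion w t \<longleftrightarrow> odd_refl (SOME p. set p \<subseteq> S \<and> word_prod p = w) t"

lemma inversion_word_prod:
  assumes "set p \<subseteq> S" "t \<in> carrier W"
  shows "inversion (word_prod p) t \<longleftrightarrow> odd_refl p t"
proof -
  let ?p = "SOME p'. set p' \<subseteq> S \<and> word_prod p' = word_prod p"
  have "set ?p \<subseteq> S \<and> word_prod ?p = word_prod p"
    by (rule someI[of _ p]) (use assms in simp)
  then show ?thesis
    unfolding inversion_def using assms by (intro odd_refl_cong) auto
qed

lemma inversion_one [simp]: "t \<in> carrier W \<Longrightarrow> \<not> inversion \<one> t"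
  using inversion_word_prod[of "[]" t] by simp

lemma inversion_gen: "s \<in> S \<Longrightarrow> t \<in> carrier W \<Longrightarrow> inversion s t \<longleftrightarrow> t = s"
  using inversion_word_prod[of "[s]" t] by simp

text \<open>The cocycle identity for inversion sets: N(xy) is the symmetric difference of N(y) and
  y^-1 N(x) y.\<close>

lemma inversion_mult:
  assumes "x \<in> carrier W" "y \<in> carrier W" "t \<in> carrier W"
  shows "inversion (x \<otimes> y) t \<longleftrightarrow> inversion x (conj_by y t) \<noteq> inversion y t"
proof -
  obtain p p' where p: "set p \<subseteq> S" "word_prod p = x" "set p' \<subseteq> S" "word_prod p' = y"
    using ex_word assms by meson
  then show ?thesis
    using assms inversion_word_prod[of "p @ p'" t] inversion_word_prod[of p "conj_by y t"]
      inversion_word_prod[of p' t] by (auto simp: odd_refl_append)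
qed

section \<open>Length and strong exchange\<close>

abbreviation len :: "'a \<Rightarrow> nat" where "len \<equiv> cox_length W S"

abbreviation T :: "'a set" where "T \<equiv> reflections W S"

abbreviation E :: "('a \<times> 'a) set" where "E \<equiv> bruhat_graph W S"

lemma ex_reduced_word:
  assumes "w \<in> carrier W"
  obtains p where "set p \<subseteq> S" "word_prod p = w" "length p = len w"
proof -
  obtain p where "set p \<subseteq> S" "word_prod p = w" using ex_word assms by blast
  then have "\<exists>n. \<exists>p\<in>lists S. length p = n \<and> foldr (\<otimes>) p \<one> = w"
    by (auto simp: word_prod_def in_lists_conv_set)
  from LeastI_ex[OF this] show thesis
    using that by (fastforce simp: cox_length_def word_prod_def in_lists_conv_set)
qed

lemma len_word_prod_le: "set p \<subseteq> S \<Longrightarrow> len (word_prod p) \<le> length p"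
  unfolding cox_length_def by (rule Least_le) (auto simp: word_prod_def in_lists_conv_set)

lemma len_one [simp]: "len \<one> = 0"
  using len_word_prod_le[of "[]"] by simp

lemma len_mult_le:
  assumes "x \<in> carrier W" "y \<in> carrier W"
  shows "len (x \<otimes> y) \<le> len x + len y"
proof -
  obtain p where p: "set p \<subseteq> S" "word_prod p = x" "length p = len x"
    using ex_reduced_word assms by blast
  obtain p' where p': "set p' \<subseteq> S" "word_prod p' = y" "length p' = len y"
    using ex_reduced_word assms by blast
  show ?thesis using len_word_prod_le[of "p @ p'"] p p' by auto
qed

lemma len_gen_le: "s \<in> S \<Longrightarrow> len s \<le> 1"
  using len_word_prod_le[of "[s]"] by simp

text \<open>An odd count gives an occurrence of \<open>t\<close>, and deleting the letter it comes
  from multiplies the product by \<open>t\<close> on the right.\<close>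

lemma strong_exchange:
  assumes "set p \<subseteq> S" "t \<in> carrier W" "odd_refl p t"
  shows "\<exists>p'. set p' \<subseteq> S \<and> length p' < length p \<and> word_prod p' = word_prod p \<otimes> t"
  using assms
proof (induction p)
  case (Cons s p)
  show ?case
  proof (cases "conj_by (word_prod p) t = s")
    case True
    then have "s \<otimes> word_prod p = word_prod p \<otimes> t"
      using mult_conj_by[of "word_prod p" t] Cons.prems by simp
    then have "word_prod p = word_prod (s # p) \<otimes> t"
      using Cons.prems by (simp add: m_assoc flip: \<open>s \<otimes> word_prod p = word_prod p \<otimes> t\<close>)
    then show ?thesis using Cons.prems by (intro exI[of _ p]) auto
  next
    case False
    then obtain p' where "set p' \<subseteq> S" "length p' < length p" "word_prod p' = word_prod p \<otimes> t"
      using Cons by auto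
    then show ?thesis using Cons.prems by (intro exI[of _ "s # p'"]) (auto simp: m_assoc)
  qed
qed simp

lemma inversion_imp_len_less:
  assumes "w \<in> carrier W" "t \<in> carrier W" "inversion w t"
  shows "len (w \<otimes> t) < len w"
proof -
  obtain p where p: "set p \<subseteq> S" "word_prod p = w" "length p = len w"
    using ex_reduced_word assms by blast
  then obtain p' where "set p' \<subseteq> S" "length p' < length p" "word_prod p' = w \<otimes> t"
    using strong_exchange[of p t] assms inversion_word_prod[of p t] by auto
  then show ?thesis using len_word_prod_le[of p'] p by simp
qed

section \<open>Reflections and the edges of the Bruhat graph\<close>

lemma reflectionE:
  assumes "t \<in> T"
  obtains g s where "g \<in> carrier W" "s \<in> S" "t = conj_by g s"
proof -
  obtain w s where "w \<in> carrier W" "s \<in> S" "t = inv w \<otimes> s \<otimes> w"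
    using assms by (auto simp: reflections_def)
  then show thesis using that[of "inv w" s] by (simp add: conj_by_def)
qed

lemma conj_by_gen_reflection: "g \<in> carrier W \<Longrightarrow> s \<in> S \<Longrightarrow> conj_by g s \<in> T"
  unfolding reflections_def conj_by_def by (rule UN_I[of "inv g"]) auto

lemma reflection_carrier [simp]: "t \<in> T \<Longrightarrow> t \<in> carrier W"
  by (elim reflectionE) simp

lemma gen_reflection [simp]: "s \<in> S \<Longrightarrow> s \<in> T"
  using conj_by_gen_reflection[of \<one> s] by simp

lemma conj_by_reflection: "g \<in> carrier W \<Longrightarrow> t \<in> T \<Longrightarrow> conj_by g t \<in> T"
  by (elim reflectionE) (simp add: conj_by_gen_reflection flip: conj_by_mult)

lemma reflection_square [simp]: "t \<in> T \<Longrightarrow> t \<otimes> t = \<one>"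
proof (elim reflectionE)
  fix g s assume g: "g \<in> carrier W" "s \<in> S" "t = conj_by g s"
  then have "t \<otimes> g = g \<otimes> s" by (simp add: mult_conj_by)
  moreover have "t = g \<otimes> (s \<otimes> inv g)" using g by (simp add: conj_by_def m_assoc)
  ultimately have "t \<otimes> t = (g \<otimes> s) \<otimes> (s \<otimes> inv g)"
    using g m_assoc[of t g "s \<otimes> inv g"] by simp
  also have "\<dots> = \<one>" using g by (simp add: m_assoc)
  finally show "t \<otimes> t = \<one>" .
qed

text \<open>Expand t = g s g^-1 by the cocycle identity. The contributions of g and g^-1 cancel
  because \<open>\<one>\<close> has no inversions; what remains is the inversion s of s.\<close>

lemma inversion_reflection_self: "t \<in> T \<Longrightarrow> inversion t t"
proof (elim reflectionE)
  fix g s assume g: "g \<in> carrier W" "s \<in> S" "t = conj_by g s"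
  then have c: "conj_by (inv g) t = s"
    by (simp flip: conj_by_mult)
  have "t = g \<otimes> (s \<otimes> inv g)" using g by (simp add: conj_by_def m_assoc)
  then have "inversion t t \<longleftrightarrow> inversion g s \<noteq> inversion (s \<otimes> inv g) t"
    using g c by (simp add: inversion_mult conj_by_mult)
  also have "\<dots> \<longleftrightarrow> inversion g s = inversion (inv g) t"
    using g c by (simp add: inversion_mult inversion_gen)
  also have "\<dots>"
    using g c inversion_mult[of g "inv g" t] by simp
  finally show "inversion t t" by simp
qed

text \<open>As \<open>t\<close> is an inversion of itself, it is one of wt, so (wt)t = w is shorter
  than wt.\<close>

lemma not_inversion_imp_len_less:
  assumes "w \<in> carrier W" "t \<in> T" "\<not> inversion w t"
  shows "len w < len (w \<otimes> t)"
proof -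
  have "inversion (w \<otimes> t) t"
    using assms inversion_reflection_self by (simp add: inversion_mult)
  then have "len (w \<otimes> t \<otimes> t) < len (w \<otimes> t)"
    using assms by (intro inversion_imp_len_less) auto
  then show ?thesis using assms by (simp add: m_assoc)
qed

lemma inversion_iff_len:
  "w \<in> carrier W \<Longrightarrow> t \<in> T \<Longrightarrow> inversion w t \<longleftrightarrow> len (w \<otimes> t) < len w"
  using inversion_imp_len_less not_inversion_imp_len_less by force

lemma bruhat_graph_iff:
  "(u, v) \<in> E \<longleftrightarrow> u \<in> carrier W \<and> (\<exists>t\<in>T. \<not> inversion u t \<and> v = u \<otimes> t)"
  by (auto simp: bruhat_graph_def inversion_iff_len intro: not_inversion_imp_len_less)

lemma inversion_mult_gen [simp]:
  "u \<in> carrier W \<Longrightarrow> s \<in> S \<Longrightarrow> inversion (u \<otimes> s) s \<longleftrightarrow> \<not> inversion u s"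
  by (simp add: inversion_mult inversion_gen)

lemma len_mult_gen:
  assumes "u \<in> carrier W" "s \<in> S"
  shows "inversion u s \<Longrightarrow> len u = Suc (len (u \<otimes> s))"
    and "\<not> inversion u s \<Longrightarrow> len (u \<otimes> s) = Suc (len u)"
proof -
  have "len (u \<otimes> s) \<le> Suc (len u)" "len (u \<otimes> s \<otimes> s) \<le> Suc (len (u \<otimes> s))"
    using len_mult_le[of u s] len_mult_le[of "u \<otimes> s" s] len_gen_le[of s] assms by auto
  then show "inversion u s \<Longrightarrow> len u = Suc (len (u \<otimes> s))"
    "\<not> inversion u s \<Longrightarrow> len (u \<otimes> s) = Suc (len u)"
    using inversion_imp_len_less[of u s] not_inversion_imp_len_less[of u s] assms by auto
qed

lemma ex_descent:
  assumes "w \<in> carrier W" "w \<noteq> \<one>"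
  obtains s where "s \<in> S" "inversion w s"
proof -
  obtain p where p: "set p \<subseteq> S" "word_prod p = w" "length p = len w"
    using ex_reduced_word assms by blast
  with assms(2) obtain p' s where p': "p = p' @ [s]" by (cases p rule: rev_cases) auto
  with p have "w \<otimes> s = word_prod p'" by auto
  then have "len (w \<otimes> s) < len w"
    using len_word_prod_le[of p'] p p' by auto
  then show thesis
    using that[of s] assms p p' by (simp add: inversion_iff_len)
qed

section \<open>Paths in the Bruhat graph\<close>

text \<open>Write v = ut. By the cocycle identity, sts is an inversion of us exactly when t is one
  of u, unless sts = s; that exception means t = s and v = us.\<close>

lemma edge_mult_gen:
  assumes "(u, v) \<in> E" "s \<in> S" "v \<noteq> u \<otimes> s"
  shows "(u \<otimes> s, v \<otimes> s) \<in> E"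
proof -
  obtain t where t: "u \<in> carrier W" "t \<in> T" "\<not> inversion u t" "v = u \<otimes> t"
    using assms by (auto simp: bruhat_graph_iff)
  have c: "conj_by s (conj_by s t) = t"
    using t assms by (simp flip: conj_by_mult)
  have "conj_by s t \<noteq> s"
    using c assms t by auto
  then have "\<not> inversion (u \<otimes> s) (conj_by s t)"
    using assms t c by (simp add: inversion_mult inversion_gen)
  moreover have "v \<otimes> s = u \<otimes> s \<otimes> conj_by s t"
    using assms t by (simp add: conj_by_def m_assoc)
  ultimately show ?thesis
    using assms t conj_by_reflection[of s t] unfolding bruhat_graph_iff by auto
qed

lemma edge_gen:
  assumes "w \<in> carrier W" "s \<in> S"
  shows "inversion w s \<Longrightarrow> (w \<otimes> s, w) \<in> E" "\<not> inversion w s \<Longrightarrow> (w, w \<otimes> s) \<in> E"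
  using assms by (auto simp: bruhat_graph_iff intro!: bexI[of _ s])

text \<open>Cut the path at its last edge, respectively first edge, of the form \<open>v \<rightarrow> vs\<close>.\<close>

lemma path_mult_gen_last:
  assumes "(u, w) \<in> E ^^ n" "u \<in> carrier W" "s \<in> S"
  shows "(u \<otimes> s, w \<otimes> s) \<in> E ^^ n \<or> (\<exists>m. n = Suc m \<and> (u, w \<otimes> s) \<in> E ^^ m)"
  using assms
proof (induction n arbitrary: w)
  case (Suc n)
  then obtain v where v: "(u, v) \<in> E ^^ n" "(v, w) \<in> E" by auto
  show ?case
  proof (cases "w = v \<otimes> s")
    case True
    then show ?thesis using v Suc.prems by (auto simp: bruhat_graph_iff)
  next
    case False
    then have "(v \<otimes> s, w \<otimes> s) \<in> E" using edge_mult_gen v Suc.prems by blast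
    then show ?thesis using Suc.IH[OF v(1)] Suc.prems by auto
  qed
qed auto

lemma path_mult_gen_first:
  assumes "(u, w) \<in> E ^^ n" "s \<in> S"
  shows "(u \<otimes> s, w \<otimes> s) \<in> E ^^ n \<or> (\<exists>m. n = Suc m \<and> (u \<otimes> s, w) \<in> E ^^ m)"
  using assms
proof (induction n arbitrary: u)
  case (Suc n)
  then obtain v where v: "(u, v) \<in> E" "(v, w) \<in> E ^^ n"
    by (meson relpow_Suc_D2)
  show ?case
  proof (cases "v = u \<otimes> s")
    case True
    then show ?thesis using v by auto
  next
    case False
    then have "(u \<otimes> s, v \<otimes> s) \<in> E" using edge_mult_gen v Suc.prems by blast
    then show ?thesis using Suc.IH[OF v(2)] Suc.prems(2) by (metis relpow_Suc_I2)
  qed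
qed auto

text \<open>The shorter alternative of \<open>path_mult_gen_first\<close> is completed by the edge
  from ws to w, so the length n is kept.\<close>

lemma path_lift:
  assumes "(u \<otimes> s, w \<otimes> s) \<in> E ^^ n" "u \<in> carrier W" "w \<in> carrier W" "s \<in> S" "inversion w s"
  shows "(u, w) \<in> E ^^ n"
proof -
  have "(u, w) \<in> E ^^ n \<or> (\<exists>m. n = Suc m \<and> (u, w \<otimes> s) \<in> E ^^ m)"
    using path_mult_gen_first[OF assms(1,4)] assms(2-4) by simp
  then show ?thesis using edge_gen(1)[of w s] assms by (metis relpow_Suc_I)
qed

text \<open>Here the completing edge runs from us to u. With \<open>path_lift\<close>, paths of each
  length correspond when s is a descent of both ends.\<close>

lemma path_lower:
  assumes "(u, w) \<in> E ^^ n" "u \<in> carrier W" "w \<in> carrier W" "s \<in> S" "inversion u s"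
  shows "(u \<otimes> s, w \<otimes> s) \<in> E ^^ n"
  using path_mult_gen_last[OF assms(1,2,4)] edge_gen(1)[of u s] assms by (metis relpow_Suc_I2)

lemma path_len: "(u, w) \<in> E ^^ n \<Longrightarrow> len u + n \<le> len w"
proof (induction n arbitrary: w)
  case (Suc n)
  then obtain v where "(u, v) \<in> E ^^ n" "(v, w) \<in> E" by auto
  with Suc.IH[of v] show ?case by (auto simp: bruhat_graph_def)
qed auto

lemma bruhat_le_iff:
  "bruhat_le W S u w \<longleftrightarrow> u \<in> carrier W \<and> w \<in> carrier W \<and> (\<exists>n. (u, w) \<in> E ^^ n)"
  by (auto simp: bruhat_le_def rtrancl_power)

lemma bruhat_le_len: "bruhat_le W S u w \<Longrightarrow> len u \<le> len w"
  using path_len[of u w] add_leD1 unfolding bruhat_le_iff by blast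

text \<open>Replaces the Bruhat comparisons in \<open>is_R_family\<close> by inversions: u and us
  are joined by an edge, whose direction is decided by length.\<close>

lemma bruhat_less_gen:
  assumes "u \<in> carrier W" "s \<in> S"
  shows "bruhat_less W S (u \<otimes> s) u \<longleftrightarrow> inversion u s"
    and "bruhat_less W S u (u \<otimes> s) \<longleftrightarrow> \<not> inversion u s"
proof -
  have E: "bruhat_less W S x y \<and> \<not> bruhat_less W S y x" if "(x, y) \<in> E" for x y
  proof -
    have "len x < len y" "x \<noteq> y" "bruhat_le W S x y"
      using that by (auto simp: bruhat_le_def bruhat_graph_def)
    then show ?thesis using bruhat_le_len[of y x] by (auto simp: bruhat_less_def)
  qed
  then show "bruhat_less W S (u \<otimes> s) u \<longleftrightarrow> inversion u s"
    and "bruhat_less W S u (u \<otimes> s) \<longleftrightarrow> \<not> inversion u s"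
    using edge_gen[OF assms] by blast+
qed

lemma bruhat_le_one_iff: "bruhat_le W S u \<one> \<longleftrightarrow> u = \<one>"
proof
  assume "bruhat_le W S u \<one>"
  then obtain n where "(u, \<one>) \<in> E ^^ n" by (auto simp: bruhat_le_iff)
  with path_len[OF this] show "u = \<one>" by simp
qed (simp add: bruhat_le_def)

section \<open>Existence and uniqueness of the R-polynomials\<close>

text \<open>
  \<open>hecke s\<close> turns \<open>\<lambda>u. R u (w \<otimes> s)\<close> into \<open>\<lambda>u. R u w\<close>. It satisfies a quadratic relation, and
  \<open>hecke_dual s\<close> is \<open>q\<close> times its inverse. The operators \<open>hecke_dual\<close> commute with their
  left-handed analogues \<open>hecke_left\<close>, and this is why a composition of them along a reduced word
  depends on the group element only.
\<close>

definition hecke :: "'a \<Rightarrow> ('a \<Rightarrow> int poly) \<Rightarrow> 'a \<Rightarrow> int poly" where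
  "hecke s f u = (if inversion u s then f (u \<otimes> s) else qvar * f (u \<otimes> s) + (qvar - 1) * f u)"

definition hecke_dual :: "'a \<Rightarrow> ('a \<Rightarrow> int poly) \<Rightarrow> 'a \<Rightarrow> int poly" where
  "hecke_dual s f u = (if inversion u s then f (u \<otimes> s) - (qvar - 1) * f u else qvar * f (u \<otimes> s))"

text \<open>Right multiplication by \<open>conj_by (inv u) r\<close> takes u to ru, so for a
  generator r the condition says that ru is shorter than u.\<close>

definition hecke_left :: "'a \<Rightarrow> ('a \<Rightarrow> int poly) \<Rightarrow> 'a \<Rightarrow> int poly" where
  "hecke_left r f u =
     (if inversion u (conj_by (inv u) r) then f (r \<otimes> u) - (qvar - 1) * f u else qvar * f (r \<otimes> u))"

lemma hecke_hecke_dual: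
  "u \<in> carrier W \<Longrightarrow> s \<in> S \<Longrightarrow> hecke s (hecke_dual s f) u = qvar * f u"
  by (simp add: hecke_def hecke_dual_def algebra_simps)

lemma hecke_dual_hecke:
  "u \<in> carrier W \<Longrightarrow> s \<in> S \<Longrightarrow> hecke_dual s (hecke s f) u = qvar * f u"
  by (simp add: hecke_def hecke_dual_def algebra_simps)

lemma hecke_scale: "hecke s (\<lambda>u. c * f u) = (\<lambda>u. c * hecke s f u)"
  by (rule ext) (simp add: hecke_def algebra_simps)

lemma hecke_dual_scale: "hecke_dual s (\<lambda>u. c * f u) = (\<lambda>u. c * hecke_dual s f u)"
  by (rule ext) (simp add: hecke_dual_def algebra_simps)

lemma foldr_hecke_scale: "foldr hecke p (\<lambda>u. c * f u) = (\<lambda>u. c * foldr hecke p f u)"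
  by (induction p) (simp_all add: hecke_scale)

text \<open>The inverse relations hold on the carrier only, so functions are compared there.\<close>

lemma foldr_hecke_cong:
  assumes "set p \<subseteq> S" "\<And>u. u \<in> carrier W \<Longrightarrow> f u = g u" "u \<in> carrier W"
  shows "foldr hecke p f u = foldr hecke p g u"
  using assms(1,3) by (induction p arbitrary: u) (simp_all add: assms(2) hecke_def)

lemma hecke_dual_cong:
  "s \<in> S \<Longrightarrow> u \<in> carrier W \<Longrightarrow> (\<And>u. u \<in> carrier W \<Longrightarrow> f u = g u) \<Longrightarrow>
   hecke_dual s f u = hecke_dual s g u"
  by (simp add: hecke_dual_def)

lemma hecke_left_cong:
  "s \<in> S \<Longrightarrow> u \<in> carrier W \<Longrightarrow> (\<And>u. u \<in> carrier W \<Longrightarrow> f u = g u) \<Longrightarrow>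
   hecke_left s f u = hecke_left s g u"
  by (simp add: hecke_left_def)

text \<open>Multiplying u by r on the left affects whether s is a right descent only if ru = us, and
  symmetrically. Apart from that case the two conditions do not interact; in it, both operators
  agree at u and at us.\<close>

lemma hecke_dual_hecke_left_commute:
  assumes u: "u \<in> carrier W" and s: "s \<in> S" and r: "r \<in> S"
  shows "hecke_dual s (hecke_left r f) u = hecke_left r (hecke_dual s f) u"
proof -
  define left where "left v \<longleftrightarrow> inversion v (conj_by (inv v) r)" for v
  have conj_eq: "conj_by (inv u) r = s \<longleftrightarrow> r \<otimes> u = u \<otimes> s"
  proof -
    have "conj_by (inv u) r = s \<longleftrightarrow> u \<otimes> conj_by (inv u) r = u \<otimes> s"
      using u s r by simp
    moreover have "u \<otimes> conj_by (inv u) r = r \<otimes> u"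
      using u r by (simp add: conj_by_def flip: m_assoc)
    ultimately show ?thesis by simp
  qed
  have "conj_by s (conj_by s x) = x" if "x \<in> carrier W" for x
    using s that by (simp flip: conj_by_mult)
  moreover have "conj_by (inv (u \<otimes> s)) r = conj_by s (conj_by (inv u) r)"
    using u s r by (simp add: inv_mult_group conj_by_mult)
  moreover have "conj_by s (conj_by (inv u) r) = s \<longleftrightarrow> conj_by (inv u) r = s"
    using u s r by (subst conj_by_eq_iff) auto
  ultimately have left_s: "left (u \<otimes> s) \<longleftrightarrow> left u \<noteq> (r \<otimes> u = u \<otimes> s)"
    using u s r conj_eq by (simp add: left_def inversion_mult inversion_gen)
  have "conj_by u s = r \<longleftrightarrow> conj_by (inv u) r = s"
    using u s r conj_by_eq_iff[of u s r] by auto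
  then have right_r: "inversion (r \<otimes> u) s \<longleftrightarrow> inversion u s \<noteq> (r \<otimes> u = u \<otimes> s)"
    using u s r conj_eq by (auto simp: inversion_mult inversion_gen)
  show ?thesis
  proof (cases "r \<otimes> u = u \<otimes> s")
    case True
    then have "conj_by (inv u) r = s" using conj_eq by simp
    then have "left u \<longleftrightarrow> inversion u s" by (simp add: left_def)
    moreover have "r \<otimes> (u \<otimes> s) = u" using u s r by (simp flip: True)
    ultimately show ?thesis
      using True left_s right_r u s r
      unfolding hecke_dual_def hecke_left_def left_def[symmetric]
      by (simp add: m_assoc)
  next
    case False
    then show ?thesis
      using left_s right_r u s r
      unfolding hecke_dual_def hecke_left_def left_def[symmetric]
      by (simp add: m_assoc algebra_simps)
  qed
qed

lemma foldr_hecke_dual_hecke_left_commute: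
  assumes "set p \<subseteq> S" "set p' \<subseteq> S" "u \<in> carrier W"
  shows "foldr hecke_dual p (foldr hecke_left p' f) u = foldr hecke_left p' (foldr hecke_dual p f) u"
  using assms(1,3)
proof (induction p arbitrary: u)
  case (Cons s p)
  have *: "hecke_dual s (foldr hecke_left p' g) u = foldr hecke_left p' (hecke_dual s g) u"
    if "u \<in> carrier W" for u g
    using assms(2) that
  proof (induction p' arbitrary: u)
    case (Cons r p')
    then have "hecke_dual s (foldr hecke_left (r # p') g) u = hecke_left r (hecke_dual s (foldr hecke_left p' g)) u"
      using \<open>set (s # p) \<subseteq> S\<close> by (simp add: hecke_dual_hecke_left_commute)
    also have "\<dots> = hecke_left r (foldr hecke_left p' (hecke_dual s g)) u"
      using Cons by (intro hecke_left_cong) auto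
    finally show ?case by simp
  qed simp
  have "foldr hecke_dual (s # p) (foldr hecke_left p' f) u =
      hecke_dual s (foldr hecke_left p' (foldr hecke_dual p f)) u"
    using Cons unfolding foldr.simps comp_def by (intro hecke_dual_cong) auto
  with * show ?case using Cons.prems by simp
qed simp

section \<open>Operators along reduced words\<close>

definition reduced :: "'a list \<Rightarrow> bool" where
  "reduced p \<longleftrightarrow> set p \<subseteq> S \<and> len (word_prod p) = length p"

lemma reduced_append:
  assumes "reduced (p @ p')"
  shows "reduced p" "reduced p'"
proof -
  have "set p \<subseteq> S" "set p' \<subseteq> S" "len (word_prod p \<otimes> word_prod p') = length p + length p'"
    using assms by (auto simp: reduced_def)
  then show "reduced p" "reduced p'"
    using len_mult_le[of "word_prod p" "word_prod p'"] len_word_prod_le[of p] len_word_prod_le[of p']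
    by (auto simp: reduced_def)
qed

lemma reduced_snoc:
  assumes "reduced (p @ [s])"
  shows "\<not> inversion (word_prod p) s"
proof -
  have "s \<in> S" "set p \<subseteq> S" "len (word_prod p \<otimes> s) = Suc (length p)"
    using assms by (auto simp: reduced_def)
  then show ?thesis
    using len_mult_gen(1)[of "word_prod p" s] reduced_append(1)[OF assms] by (auto simp: reduced_def)
qed

lemma reduced_Cons:
  assumes "reduced (r # p)"
  shows "\<not> inversion (word_prod p) (conj_by (inv (word_prod p)) r)"
proof
  let ?w = "word_prod p"
  assume inv: "inversion ?w (conj_by (inv ?w) r)"
  have p: "r \<in> S" "set p \<subseteq> S" "len (r \<otimes> ?w) = Suc (length p)"
    using assms by (auto simp: reduced_def)
  then have "?w \<otimes> conj_by (inv ?w) r = r \<otimes> ?w"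
    by (simp add: conj_by_def flip: m_assoc)
  then have "len (r \<otimes> ?w) < len ?w"
    using inversion_imp_len_less[OF _ _ inv] p by simp
  then show False using p len_word_prod_le[of p] by simp
qed

text \<open>Every letter of a reduced word is an ascent, where \<open>hecke_dual\<close>, unlike
  \<open>hecke\<close>, has a single term.\<close>

lemma foldr_hecke_dual_eval:
  assumes "reduced (p @ p')"
  shows "foldr hecke_dual p' f (word_prod p) = qvar ^ length p' * f (word_prod (p @ p'))"
  using assms
proof (induction p' arbitrary: p)
  case (Cons s p')
  then have "reduced ((p @ [s]) @ p')" by simp
  note IH = Cons.IH[OF this] reduced_snoc[OF reduced_append(1)[OF this]]
  have "set p \<subseteq> S" "s \<in> S" using Cons.prems by (auto simp: reduced_def)
  with IH show ?case by (simp add: hecke_dual_def)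
qed simp

text \<open>The head of the list is multiplied on first, next to \<open>p\<close>; hence the
  reversal.\<close>

lemma foldr_hecke_left_eval:
  assumes "reduced (rev p' @ p)"
  shows "foldr hecke_left p' f (word_prod p) = qvar ^ length p' * f (word_prod (rev p' @ p))"
  using assms
proof (induction p' arbitrary: p)
  case (Cons s p')
  then have red: "reduced (rev p' @ (s # p))" by simp
  note IH = Cons.IH[OF this] reduced_Cons[OF reduced_append(2)[OF this]]
  have "set p \<subseteq> S" "s \<in> S" using Cons.prems by (auto simp: reduced_def)
  with IH show ?case by (simp add: hecke_left_def)
qed simp

lemma ex_reduced:
  assumes "w \<in> carrier W"
  obtains p where "reduced p" "word_prod p = w"
  using ex_reduced_word[OF assms] by (metis reduced_def)

text \<open>A \<open>hecke_left\<close> composition along a reduced word of u moves the evaluation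
  from u to \<open>\<one>\<close>. After commuting, \<open>hecke_dual\<close> is evaluated at
  \<open>\<one>\<close>, which sees only the group element and the length; the power of q
  cancels.\<close>

lemma foldr_hecke_dual_unique:
  assumes "reduced p" "reduced p'" "word_prod p = word_prod p'" "u \<in> carrier W"
  shows "foldr hecke_dual p f u = foldr hecke_dual p' f u"
proof -
  obtain r where r: "reduced r" "word_prod r = u" using ex_reduced assms(4) by blast
  have *: "qvar ^ length r * foldr hecke_dual x f u =
      qvar ^ length x * foldr hecke_left (rev r) f (word_prod x)" if "reduced x" for x
  proof -
    have "qvar ^ length r * foldr hecke_dual x f u = foldr hecke_left (rev r) (foldr hecke_dual x f) \<one>"
      using foldr_hecke_left_eval[of "rev r" "[]"] r by simp
    also have "\<dots> = foldr hecke_dual x (foldr hecke_left (rev r) f) \<one>"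
      using r that by (subst foldr_hecke_dual_hecke_left_commute) (auto simp: reduced_def)
    also have "\<dots> = qvar ^ length x * foldr hecke_left (rev r) f (word_prod x)"
      using foldr_hecke_dual_eval[of "[]" x] that by simp
    finally show ?thesis .
  qed
  have "length p = length p'" using assms by (simp add: reduced_def)
  then have "qvar ^ length r * foldr hecke_dual p f u = qvar ^ length r * foldr hecke_dual p' f u"
    using *[of p] *[of p'] assms by simp
  then show ?thesis by simp
qed

lemma foldr_hecke_dual_hecke_rev:
  assumes "set p \<subseteq> S" "u \<in> carrier W"
  shows "foldr hecke_dual p (foldr hecke (rev p) f) u = qvar ^ length p * f u"
  using assms
proof (induction p arbitrary: f u)
  case (Cons s p)
  then have "foldr hecke_dual (s # p) (foldr hecke (rev (s # p)) f) u =
      hecke_dual s (\<lambda>u. qvar ^ length p * hecke s f u) u"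
    by (auto intro!: hecke_dual_cong)
  also have "\<dots> = qvar ^ length (s # p) * f u"
    using Cons.prems by (simp add: hecke_dual_scale hecke_dual_hecke mult.assoc mult.left_commute)
  finally show ?case .
qed simp

lemma foldr_hecke_rev_hecke_dual:
  assumes "set p \<subseteq> S" "u \<in> carrier W"
  shows "foldr hecke (rev p) (foldr hecke_dual p f) u = qvar ^ length p * f u"
  using assms
proof (induction p arbitrary: f u)
  case (Cons s p)
  then have "foldr hecke (rev (s # p)) (foldr hecke_dual (s # p) f) u =
      foldr hecke (rev p) (\<lambda>u. qvar * foldr hecke_dual p f u) u"
    by (auto intro!: foldr_hecke_cong simp: hecke_hecke_dual)
  also have "\<dots> = qvar ^ length (s # p) * f u"
    using Cons by (simp add: foldr_hecke_scale)
  finally show ?case .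
qed simp

text \<open>Up to a power of q, \<open>hecke\<close> along the reversed word inverts
  \<open>hecke_dual\<close> along the word, so independence of the word carries over.\<close>

lemma foldr_hecke_unique:
  assumes p: "reduced p" and p': "reduced p'" and eq: "word_prod p = word_prod p'"
    and u: "u \<in> carrier W"
  shows "foldr hecke (rev p) f u = foldr hecke (rev p') f u"
proof -
  let ?g = "foldr hecke (rev p) f" and ?h = "foldr hecke (rev p') f"
  have S: "set p \<subseteq> S" "set p' \<subseteq> S" and len_eq: "length p = length p'"
    using p p' eq by (auto simp: reduced_def)
  have "foldr hecke_dual p ?g v = foldr hecke_dual p ?h v" if "v \<in> carrier W" for v
    using foldr_hecke_dual_hecke_rev[OF S(1) that, of f] foldr_hecke_dual_hecke_rev[OF S(2) that, of f]
      foldr_hecke_dual_unique[OF p p' eq that, of ?h] len_eq by simp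
  then have "foldr hecke (rev p) (foldr hecke_dual p ?g) u = foldr hecke (rev p) (foldr hecke_dual p ?h) u"
    using S u by (intro foldr_hecke_cong) auto
  then have "qvar ^ length p * ?g u = qvar ^ length p * ?h u"
    using foldr_hecke_rev_hecke_dual[OF S(1) u] by simp
  then show ?thesis by simp
qed

text \<open>The starting function is R(-, 1), and each letter performs one step of the
  recursion.\<close>

definition hecke_R :: "'a \<Rightarrow> 'a \<Rightarrow> int poly" where
  "hecke_R u w = (if u \<in> carrier W \<and> w \<in> carrier W
     then foldr hecke (rev (SOME p. reduced p \<and> word_prod p = w)) (\<lambda>u. if u = \<one> then 1 else 0) u else 0)"

lemma hecke_R_word:
  assumes "reduced p" "u \<in> carrier W"
  shows "hecke_R u (word_prod p) = foldr hecke (rev p) (\<lambda>u. if u = \<one> then 1 else 0) u"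
proof -
  let ?p = "SOME p'. reduced p' \<and> word_prod p' = word_prod p"
  have "reduced ?p \<and> word_prod ?p = word_prod p"
    by (rule someI[of _ p]) (use assms in simp)
  moreover have "word_prod p \<in> carrier W" using assms by (auto simp: reduced_def)
  ultimately show ?thesis
    using assms foldr_hecke_unique[of ?p p] by (simp add: hecke_R_def)
qed

lemma hecke_R_one: "u \<in> carrier W \<Longrightarrow> hecke_R u \<one> = (if u = \<one> then 1 else 0)"
  using hecke_R_word[of "[]" u] by (simp add: reduced_def)

lemma hecke_R_rec:
  assumes "u \<in> carrier W" "w \<in> carrier W" "s \<in> S" "inversion w s"
  shows "hecke_R u w = hecke s (\<lambda>u. hecke_R u (w \<otimes> s)) u"
proof -
  obtain p where p: "reduced p" "word_prod p = w \<otimes> s"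
    using ex_reduced[of "w \<otimes> s"] assms by auto
  then have "word_prod (p @ [s]) = w"
    using assms by (simp add: reduced_def)
  moreover from this have "reduced (p @ [s])"
    using p assms len_mult_gen(1)[of w s] by (auto simp: reduced_def)
  ultimately have "hecke_R u w = hecke s (foldr hecke (rev p) (\<lambda>u. if u = \<one> then 1 else 0)) u"
    using hecke_R_word[of "p @ [s]" u] assms by simp
  also have "\<dots> = hecke s (\<lambda>u. hecke_R u (w \<otimes> s)) u"
    using hecke_R_word[OF p(1)] p(2) assms by (simp add: hecke_def)
  finally show ?thesis .
qed

lemma len_induct [consumes 1, case_names one descent]:
  assumes "w \<in> carrier W" "P \<one>"
    and "\<And>w s. w \<in> carrier W \<Longrightarrow> s \<in> S \<Longrightarrow> inversion w s \<Longrightarrow> P (w \<otimes> s) \<Longrightarrow> P w"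
  shows "P w"
  using assms(1)
proof (induction "len w" arbitrary: w rule: less_induct)
  case less
  show ?case
  proof (cases "w = \<one>")
    case False
    then obtain s where s: "s \<in> S" "inversion w s" using ex_descent less.prems by blast
    then show ?thesis
      using less assms(3) inversion_imp_len_less[of w s] by simp
  qed (use assms(2) in simp)
qed

lemma is_R_family_iff:
  "is_R_family W S R \<longleftrightarrow>
     (\<forall>u w. \<not> bruhat_le W S u w \<longrightarrow> R u w = 0) \<and> (\<forall>w\<in>carrier W. R w w = 1) \<and>
     (\<forall>u\<in>carrier W. \<forall>w\<in>carrier W. \<forall>s\<in>S. inversion w s \<longrightarrow>
        R u w = hecke s (\<lambda>u. R u (w \<otimes> s)) u)"
proof -
  have "(bruhat_less W S (w \<otimes> s) w \<longrightarrow>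
        (bruhat_less W S (u \<otimes> s) u \<longrightarrow> R u w = R (u \<otimes> s) (w \<otimes> s)) \<and>
        (bruhat_less W S u (u \<otimes> s) \<longrightarrow>
           R u w = [:0, 1:] * R (u \<otimes> s) (w \<otimes> s) + [:-1, 1:] * R u (w \<otimes> s))) \<longleftrightarrow>
     (inversion w s \<longrightarrow> R u w = hecke s (\<lambda>u. R u (w \<otimes> s)) u)"
    if "u \<in> carrier W" "w \<in> carrier W" "s \<in> S" for u w s
    unfolding bruhat_less_gen[OF that(1,3)] bruhat_less_gen[OF that(2,3)] hecke_def
      qvar_minus_one[symmetric] qvar_def[symmetric] by (cases "inversion u s") simp_all
  then show ?thesis unfolding is_R_family_def by (simp only: cong: ball_cong)
qed

lemma is_R_family_hecke_R: "is_R_family W S hecke_R"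
proof -
  have "w \<in> carrier W \<Longrightarrow> (\<forall>u. \<not> bruhat_le W S u w \<longrightarrow> hecke_R u w = 0) \<and> hecke_R w w = 1" for w
  proof (induction w rule: len_induct)
    case one
    have "hecke_R u \<one> = 0" if "u \<noteq> \<one>" for u
      using that hecke_R_one[of u] by (cases "u \<in> carrier W") (simp_all add: hecke_R_def)
    then show ?case by (simp add: hecke_R_one bruhat_le_one_iff)
  next
    case (descent w s)
    have "hecke_R u w = 0" if u: "\<not> bruhat_le W S u w" "u \<in> carrier W" for u
    proof -
      \<comment> \<open>Either relation would give u \<le> w, by lifting or by the edge from ws to
        w; so all terms of the recursion vanish.\<close>
      have "\<not> bruhat_le W S (u \<otimes> s) (w \<otimes> s)"
        using u path_lift[of u s w] descent unfolding bruhat_le_iff by blast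
      moreover have "\<not> bruhat_le W S u (w \<otimes> s)"
        using u edge_gen(1)[of w s] descent unfolding bruhat_le_iff by (meson relpow_Suc_I)
      ultimately show ?thesis
        using u descent by (simp add: hecke_R_rec[of u w s] hecke_def)
    qed
    moreover have "hecke_R w w = 1"
      using descent by (simp add: hecke_R_rec[of w w s] hecke_def)
    ultimately show ?case by (auto simp: hecke_R_def)
  qed
  moreover have "hecke_R u w = 0" if "w \<notin> carrier W" for u w
    using that by (simp add: hecke_R_def)
  ultimately show ?thesis
    unfolding is_R_family_iff using hecke_R_rec by blast
qed

lemma is_R_family_unique:
  assumes R: "is_R_family W S R" and R': "is_R_family W S R'"
  shows "R = R'"
proof -
  have "w \<in> carrier W \<Longrightarrow> \<forall>u\<in>carrier W. R u w = R' u w" for w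
  proof (induction w rule: len_induct)
    case one
    show ?case
    proof
      fix u
      \<comment> \<open>Only \<open>\<one>\<close> lies below \<open>\<one>\<close>, so the first
        two clauses of \<open>is_R_family\<close> fix these values.\<close>
      show "R u \<one> = R' u \<one>"
        using R R' bruhat_le_one_iff[of u] unfolding is_R_family_iff by (cases "u = \<one>") auto
    qed
  next
    case (descent w s)
    show ?case
    proof
      fix u assume u: "u \<in> carrier W"
      then have "R u w = hecke s (\<lambda>u. R u (w \<otimes> s)) u" "R' u w = hecke s (\<lambda>u. R' u (w \<otimes> s)) u"
        using R R' descent unfolding is_R_family_iff by auto
      with descent u show "R u w = R' u w" by (simp add: hecke_def)
    qed
  qed
  moreover have "R u w = R' u w" if "\<not> (u \<in> carrier W \<and> w \<in> carrier W)" for u w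
    using R R' that by (auto simp: is_R_family_def bruhat_le_def)
  ultimately show ?thesis by blast
qed

lemma is_R_family_R_poly: "is_R_family W S (R_poly W S)"
  unfolding R_poly_def
  by (rule theI[of "is_R_family W S", OF is_R_family_hecke_R]) (rule is_R_family_unique[OF _ is_R_family_hecke_R])

section \<open>Coefficients in powers of q - 1\<close>

text \<open>Substituting q = 1 + x makes the expansion in powers of q - 1 an ordinary one, still
  over the integers.\<close>

definition qm1_coeff :: "'a \<Rightarrow> 'a \<Rightarrow> nat \<Rightarrow> int" where
  "qm1_coeff u w n = coeff (pcompose (R_poly W S u w) [:1, 1:]) n"

lemma qm1_coeff_one:
  "u \<in> carrier W \<Longrightarrow> qm1_coeff u \<one> n = (if u = \<one> \<and> n = 0 then 1 else 0)"
  using is_R_family_R_poly bruhat_le_one_iff[of u] unfolding is_R_family_iff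
  by (auto simp: qm1_coeff_def pcompose_1)

lemma qm1_coeff_rec:
  assumes "u \<in> carrier W" "w \<in> carrier W" "s \<in> S" "inversion w s"
  shows "inversion u s \<Longrightarrow> qm1_coeff u w n = qm1_coeff (u \<otimes> s) (w \<otimes> s) n"
    and "\<not> inversion u s \<Longrightarrow> qm1_coeff u w n = qm1_coeff (u \<otimes> s) (w \<otimes> s) n +
      (if n = 0 then 0 else qm1_coeff (u \<otimes> s) (w \<otimes> s) (n - 1) + qm1_coeff u (w \<otimes> s) (n - 1))"
proof -
  have *: "R_poly W S u w = hecke s (\<lambda>u. R_poly W S u (w \<otimes> s)) u"
    using is_R_family_R_poly assms unfolding is_R_family_iff by blast
  show "inversion u s \<Longrightarrow> qm1_coeff u w n = qm1_coeff (u \<otimes> s) (w \<otimes> s) n"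
    by (simp add: qm1_coeff_def * hecke_def)
  \<comment> \<open>q becomes 1 + x and q - 1 becomes x; a factor x shifts the index, hence
    \<open>n - 1\<close> and the value 0 at n = 0.\<close>
  have "pcompose qvar [:1, 1:] = [:1, 1:]" "pcompose (qvar - 1) [:1, 1:] = [:0, 1:]"
    by (simp_all add: qvar_minus_one) (simp_all add: qvar_def pcompose_pCons)
  then show "\<not> inversion u s \<Longrightarrow> qm1_coeff u w n = qm1_coeff (u \<otimes> s) (w \<otimes> s) n +
      (if n = 0 then 0 else qm1_coeff (u \<otimes> s) (w \<otimes> s) (n - 1) + qm1_coeff u (w \<otimes> s) (n - 1))"
    by (simp add: qm1_coeff_def * hecke_def pcompose_add pcompose_mult coeff_pCons split: nat.split)
qed

text \<open>
  In the recursion the first and third summand are positive for \<open>n\<close> in \<open>[a(us, ws), \<ell>(u, w) - 2]\<close>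
  and \<open>[a(u, ws) + 1, \<ell>(u, w)]\<close>; the second one fills the possible gap between these intervals.
\<close>

lemma qm1_coeff_pos_iff:
  assumes "w \<in> carrier W"
  shows "\<forall>u\<in>carrier W. \<forall>n. 0 \<le> qm1_coeff u w n \<and>
    (0 < qm1_coeff u w n \<longleftrightarrow> (\<exists>m\<le>n. (u, w) \<in> E ^^ m) \<and> n + len u \<le> len w)"
  using assms
proof (induction w rule: len_induct)
  case one
  have "u = \<one>" if "(u, \<one>) \<in> E ^^ m" "u \<in> carrier W" for u m
    using that bruhat_le_one_iff[of u] by (auto simp: bruhat_le_iff)
  then show ?case by (auto simp: qm1_coeff_one intro!: exI[of _ "0::nat"])
next
  case (descent w s)
  have w: "len w = Suc (len (w \<otimes> s))"
    using descent len_mult_gen(1) by simp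
  show ?case
  proof (intro ballI allI)
    fix u n assume u: "u \<in> carrier W"
    then have us: "u \<otimes> s \<in> carrier W" using descent by simp
    note IH = descent.IH[rule_format, OF us] descent.IH[rule_format, OF u]
    show "0 \<le> qm1_coeff u w n \<and>
      (0 < qm1_coeff u w n \<longleftrightarrow> (\<exists>m\<le>n. (u, w) \<in> E ^^ m) \<and> n + len u \<le> len w)"
    proof (cases "inversion u s")
      case True
      then have "len u = Suc (len (u \<otimes> s))"
        using len_mult_gen(1) u descent by simp
      moreover have "(u \<otimes> s, w \<otimes> s) \<in> E ^^ m \<longleftrightarrow> (u, w) \<in> E ^^ m" for m
        using path_lift[of u s w m] path_lower[of u w m s] True u descent by blast
      moreover have "qm1_coeff u w n = qm1_coeff (u \<otimes> s) (w \<otimes> s) n"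
        using qm1_coeff_rec(1) True u descent by simp
      ultimately show ?thesis
        using IH(1)[of n] w by simp
    next
      case False
      then have l: "len (u \<otimes> s) = Suc (len u)"
        using len_mult_gen(2) u descent by simp
      have up1: "(u, w) \<in> E ^^ m" if "(u \<otimes> s, w \<otimes> s) \<in> E ^^ m" for m
        using path_lift[OF that] u descent by blast
      have up2: "(u, w) \<in> E ^^ Suc m" if "(u, w \<otimes> s) \<in> E ^^ m" for m
        using that edge_gen(1)[of w s] descent by (meson relpow_Suc_I)
      \<comment> \<open>The length bounds are those of the induction hypothesis, rewritten for u and
        w: us is one longer than u, and ws one shorter than w.\<close>
      define A where "A k \<longleftrightarrow> (\<exists>m\<le>k. (u \<otimes> s, w \<otimes> s) \<in> E ^^ m) \<and> k + len u + 2 \<le> len w" for k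
      define B where "B k \<longleftrightarrow> (\<exists>m\<le>k. (u, w \<otimes> s) \<in> E ^^ m) \<and> Suc k + len u \<le> len w" for k
      have A: "0 < qm1_coeff (u \<otimes> s) (w \<otimes> s) k \<longleftrightarrow> A k" for k
        using IH(1)[of k] l w by (simp add: A_def)
      have B: "0 < qm1_coeff u (w \<otimes> s) k \<longleftrightarrow> B k" for k
        using IH(2)[of k] w by (simp add: B_def)
      have nonneg: "0 \<le> qm1_coeff (u \<otimes> s) (w \<otimes> s) k" "0 \<le> qm1_coeff u (w \<otimes> s) k" for k
        using IH by blast+
      note rec = qm1_coeff_rec(2)[OF u descent.hyps False, of n]
      \<comment> \<open>A sum of nonnegative terms is positive exactly when one term is.\<close>
      have "0 < qm1_coeff u w n \<longleftrightarrow> A n \<or> (n > 0 \<and> (A (n - 1) \<or> B (n - 1)))"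
        unfolding rec A[symmetric] B[symmetric]
        using nonneg(1)[of n] nonneg[of "n - 1"] by auto
      also have "\<dots> \<longleftrightarrow> (\<exists>m\<le>n. (u, w) \<in> E ^^ m) \<and> n + len u \<le> len w"
      proof
        assume "A n \<or> (n > 0 \<and> (A (n - 1) \<or> B (n - 1)))"
        then consider "A n" | "n > 0" "A (n - 1)" | "n > 0" "B (n - 1)" by blast
        then show "(\<exists>m\<le>n. (u, w) \<in> E ^^ m) \<and> n + len u \<le> len w"
        proof cases
          case 1
          then obtain m where m: "m \<le> n" "(u \<otimes> s, w \<otimes> s) \<in> E ^^ m" "n + len u \<le> len w"
            by (auto simp: A_def)
          then show ?thesis using up1[OF m(2)] by blast
        next
          case 2
          then obtain m where m: "m \<le> n - 1" "(u \<otimes> s, w \<otimes> s) \<in> E ^^ m" "n + len u \<le> len w"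
            by (auto simp: A_def)
          then have "m \<le> n" by simp
          then show ?thesis using up1[OF m(2)] m(3) by blast
        next
          case 3
          then obtain m where m: "m \<le> n - 1" "(u, w \<otimes> s) \<in> E ^^ m" "n + len u \<le> len w"
            by (auto simp: B_def)
          with 3 have "Suc m \<le> n" by simp
          then show ?thesis using up2[OF m(2)] m(3) by blast
        qed
      next
        assume n: "(\<exists>m\<le>n. (u, w) \<in> E ^^ m) \<and> n + len u \<le> len w"
        then obtain m where m: "m \<le> n" "(u, w) \<in> E ^^ m" by blast
        have B_pred: "n > 0 \<and> B (n - 1)" if "(u, w \<otimes> s) \<in> E ^^ k" "Suc k \<le> n" for k
          using that n by (auto simp: B_def intro!: exI[of _ k])
        from path_mult_gen_last[OF m(2) u \<open>s \<in> S\<close>]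
        show "A n \<or> (n > 0 \<and> (A (n - 1) \<or> B (n - 1)))"
        proof
          assume p: "(u \<otimes> s, w \<otimes> s) \<in> E ^^ m"
          \<comment> \<open>So m \<le> \<ell>(u, w) - 2, and the cases n \<le> \<ell>(u, w) - 2, n =
            \<ell>(u, w) - 1 and n = \<ell>(u, w) use the three summands in turn.\<close>
          then have "m + len u + 2 \<le> len w"
            using path_len[OF p] l w by simp
          then consider "n + len u + 2 \<le> len w" | "n + len u + 1 = len w" "Suc m \<le> n"
            | "n + len u = len w" "Suc (Suc m) \<le> n"
            using n by linarith
          then show ?thesis
          proof cases
            case 1
            then show ?thesis using p m(1) by (auto simp: A_def)
          next
            case 2
            then have "A (n - 1)"
              unfolding A_def using p by (intro conjI exI[of _ m]) auto
            then show ?thesis using 2 by simp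
          next
            case 3
            \<comment> \<open>Prepending this edge gives a path from u to ws of length m + 1 <
              n.\<close>
            have "(u, u \<otimes> s) \<in> E" using edge_gen(2) False u descent by blast
            then have "(u, w \<otimes> s) \<in> E ^^ Suc m" using p by (rule relpow_Suc_I2)
            then show ?thesis using B_pred 3 by blast
          qed
        next
          assume "\<exists>k. m = Suc k \<and> (u, w \<otimes> s) \<in> E ^^ k"
          then show ?thesis using B_pred m(1) by blast
        qed
      qed
      finally show ?thesis
        using nonneg(1)[of n] nonneg[of "n - 1"] unfolding rec by auto
    qed
  qed
qed

end

section \<open>Taylor coefficients at q = 1\<close>

lemma coeff_pcompose_shift: "coeff (pcompose f [:1, 1:]) n = coeff_qm1 n f"
proof -
  \<comment> \<open>The inner polynomial has derivative 1, so differentiation commutes with the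
    shift.\<close>
  have "(pderiv ^^ n) (pcompose f [:1, 1:]) = pcompose ((pderiv ^^ n) f) [:1, 1:]"
    by (induction n) (simp_all add: pderiv_pcompose pderiv_pCons)
  then have "poly ((pderiv ^^ n) f) 1 = coeff ((pderiv ^^ n) (pcompose f [:1, 1:])) 0"
    by (simp add: poly_pcompose flip: poly_0_coeff_0)
  also have "\<dots> = fact n * coeff (pcompose f [:1, 1:]) n"
    by (simp add: coeff_higher_pderiv pochhammer_fact)
  finally show ?thesis by (simp add: coeff_qm1_def)
qed

lemma coeff_pcompose_shift_of_int:
  "coeff (pcompose (map_poly real_of_int p) [:1, 1:]) n = of_int (coeff (pcompose p [:1, 1:]) n)"
proof (induction p arbitrary: n)
  case (pCons a p)
  then show ?case
    by (simp add: map_poly_pCons pcompose_pCons coeff_pCons split: nat.split)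
qed simp

text \<open>The substitution q -> q + 1 is invertible and preserves divisibility, which reduces the
  claim to powers of the variable.\<close>

lemma qm1_power_dvd_iff:
  fixes p :: "int poly"
  shows "[:-1, 1:] ^ k dvd p \<longleftrightarrow> (\<forall>n<k. coeff (pcompose p [:1, 1:]) n = 0)"
proof -
  have power: "pcompose (f ^ k) g = pcompose f g ^ k" for f g :: "int poly"
    by (induction k) (simp_all add: pcompose_mult pcompose_1)
  have dvd: "pcompose f g dvd pcompose h g" if "f dvd h" for f g h :: "int poly"
    using that by (auto simp: pcompose_mult)
  have X: "pcompose [:-1, 1:] [:1, 1:] = [:0, 1::int:]" "pcompose [:1, 1:] [:-1, 1:] = [:0, 1::int:]"
    "pcompose [:0, 1:] [:-1, 1:] = [:-1, 1::int:]"
    by (simp_all add: pcompose_pCons)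
  have "[:-1, 1:] ^ k dvd p \<longleftrightarrow> [:0, 1:] ^ k dvd pcompose p [:1, 1:]"
  proof
    assume "[:-1, 1:] ^ k dvd p"
    from dvd[OF this, of "[:1, 1:]"] show "[:0, 1:] ^ k dvd pcompose p [:1, 1:]"
      by (simp only: power X)
  next
    assume "[:0, 1:] ^ k dvd pcompose p [:1, 1:]"
    from dvd[OF this, of "[:-1, 1:]"] show "[:-1, 1:] ^ k dvd p"
      by (simp only: power X pcompose_idR flip: pcompose_assoc)
  qed
  also have "[:0, 1:] ^ k = monom (1::int) k"
    by (simp add: monom_altdef)
  finally show ?thesis by (simp only: monom_1_dvd_iff')
qed

theorem theorem1:
  fixes W :: "('a, 'b) monoid_scheme" and S :: "'a set"
  assumes "coxeter_system W S"
  shows "(\<forall>u\<in>carrier W. \<forall>w\<in>carrier W. bruhat_less W S u w \<longrightarrow>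
            (\<forall>n::nat.
               (n < absolute_length W S u w \<or> int n > rel_length W S u w \<longrightarrow>
                  coeff_qm1 n (real_R_poly W S u w) = 0) \<and>
               (absolute_length W S u w \<le> n \<and> int n \<le> rel_length W S u w \<longrightarrow>
                  coeff_qm1 n (real_R_poly W S u w) > 0)) \<and>
            [:-1, 1:] ^ absolute_length W S u w dvd R_poly W S u w \<and>
            (\<forall>k::nat. [:-1, 1:] ^ k dvd R_poly W S u w \<longrightarrow> k \<le> absolute_length W S u w))
       \<and> (\<forall>u\<in>carrier W. \<forall>w\<in>carrier W. le_qm1 0 (real_R_poly W S u w))"
proof -
  interpret group W using assms by (simp add: coxeter_system_def)
  interpret coxeter W S by unfold_locales (rule assms)
  have coeff: "coeff_qm1 n (real_R_poly W S u w) = of_int (qm1_coeff u w n)" for n u w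
    by (simp add: real_R_poly_def qm1_coeff_def coeff_pcompose_shift_of_int flip: coeff_pcompose_shift)
  have pos: "0 < qm1_coeff u w n \<longleftrightarrow> (\<exists>m\<le>n. (u, w) \<in> E ^^ m) \<and> n + len u \<le> len w"
    and nonneg: "0 \<le> qm1_coeff u w n" if "u \<in> carrier W" "w \<in> carrier W" for u w n
    using qm1_coeff_pos_iff that by blast+
  have zero: "qm1_coeff u w n = 0 \<longleftrightarrow> \<not> 0 < qm1_coeff u w n" if "u \<in> carrier W" "w \<in> carrier W" for u w n
    using nonneg[OF that, of n] by linarith
  have "(\<forall>n::nat.
           (n < absolute_length W S u w \<or> int n > rel_length W S u w \<longrightarrow>
              coeff_qm1 n (real_R_poly W S u w) = 0) \<and>
           (absolute_length W S u w \<le> n \<and> int n \<le> rel_length W S u w \<longrightarrow>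
              coeff_qm1 n (real_R_poly W S u w) > 0)) \<and>
        [:-1, 1:] ^ absolute_length W S u w dvd R_poly W S u w \<and>
        (\<forall>k::nat. [:-1, 1:] ^ k dvd R_poly W S u w \<longrightarrow> k \<le> absolute_length W S u w)"
    if u: "u \<in> carrier W" and w: "w \<in> carrier W" and less: "bruhat_less W S u w" for u w
  proof -
    let ?a = "absolute_length W S u w"
    have "\<exists>n. (u, w) \<in> E ^^ n" using less by (simp add: bruhat_less_def bruhat_le_iff)
    then have a: "(u, w) \<in> E ^^ ?a" unfolding absolute_length_def by (rule LeastI_ex)
    have "?a \<le> n" if "(u, w) \<in> E ^^ n" for n
      unfolding absolute_length_def using that by (rule Least_le)
    then have path: "(\<exists>m\<le>n. (u, w) \<in> E ^^ m) \<longleftrightarrow> ?a \<le> n" for n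
      using a order_trans by blast
    have pos': "0 < qm1_coeff u w n \<longleftrightarrow> ?a \<le> n \<and> int n \<le> rel_length W S u w" for n
      unfolding pos[OF u w] path rel_length_def by linarith
    have zero': "qm1_coeff u w n = 0 \<longleftrightarrow> n < ?a \<or> int n > rel_length W S u w" for n
      unfolding zero[OF u w] pos' by linarith
    \<comment> \<open>Hence the coefficient at a(u, w) lies in the positive range, which bounds the
      exponent k.\<close>
    have "int ?a \<le> rel_length W S u w"
      using path_len[OF a] by (simp add: rel_length_def)
    then have "qm1_coeff u w ?a \<noteq> 0" unfolding zero' by simp
    then show ?thesis
      unfolding coeff qm1_power_dvd_iff qm1_coeff_def[symmetric] of_int_eq_0_iff of_int_0_less_iff
      using pos' zero' not_le by blast
  qed
  moreover have "le_qm1 0 (real_R_poly W S u w)" if "u \<in> carrier W" "w \<in> carrier W" for u w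
    using nonneg[OF that] by (simp add: le_qm1_def coeff) (simp add: coeff_qm1_def)
  ultimately show ?thesis by blast
qed

end
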